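(* Let $(A,1_l)$ be a left-unital domain. Then $AC_l(A)=Z(A)$ if $(A,1_l)$ is associative, and $AC_l(A)\cdot 1_l=\{0\}$ otherwise. Moreover, the following statements are true: 1) Any left-unital hom-associative domain is either trivial or associative. 2) Any two-sided unital hom-associative domain is either trivial or associative. 3) Any two-sided unital hom-associative division algebra is either trivial or associative.
   Context: An algebra $A$ over a field $\mathbb{F}$ is a linear space with a bilinear product $(x,y)\mapsto x\cdot y$ (not assumed associative or commutative). It is left-unital if equipped with $1_l\in A$ with $1_l\cdot x=x$ for all $x\in A$, and two-sided unital if it has $1_{lr}$ with $1_{lr}\cdot x=x=x\cdot 1_{lr}$ for all $x$. A domain is an algebra in which all left and right multiplication operators by nonzero elements are injective (for associative algebras: every nonzero element is two-sided regular). A division algebra is, in the associative case, one in which every nonzero element is invertible and, in the non-associative case, one in which all left and right multiplication operators by nonzero elements are bijective. A hom-associative algebra $(A,\alpha)$ is an algebra with a linear map $\alpha\colon A\to A$ such that $\alpha(x)\cdot(y\cdot z)=(x\cdot y)\cdot\alpha(z)$ for all $x,y,z\in A$; it is called a domain, division algebra, unital or associative when its underlying algebra is. The twisting map $\alpha$ is trivial if $\alpha=\lambda\,\mathrm{id}_A$ for some $\lambda\in\mathbb{F}$; a hom-associative algebra is called trivial here when its twisting map is trivial. $Z(A)=\{a\in A\mid a\cdot x=x\cdot a\ \forall x\in A\}$, $$AC_l(A)=\{a\in A\mid a\cdot(x\cdot z)=x\cdot(a\cdot z),\ (a\cdot x)\cdot(y\cdot z)=a\cdot((x\cdot y)\cdot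 z)\ \forall x,y,z\in A\},$$ $$AC_l(A)\cdot 1_l=\{a\cdot 1_l\mid a\in AC_l(A)\}.$$ *)

theory Defs
  imports Complex_Main
begin

text \<open>
  The carrier of an algebra is the whole type \<open>'a\<close>; its product is an explicit
  operation \<open>mult\<close>, since no associativity, commutativity or unit is assumed.
\<close>

locale nonassoc_algebra = vector_space scale
  for scale :: "'f::field \<Rightarrow> 'a::ab_group_add \<Rightarrow> 'a" +
  fixes mult :: "'a \<Rightarrow> 'a \<Rightarrow> 'a"
  assumes linear_mult_left: "Vector_Spaces.linear scale scale (\<lambda>y. mult x y)"
    and linear_mult_right: "Vector_Spaces.linear scale scale (\<lambda>x. mult x y)"

locale hom_associative_algebra = nonassoc_algebra scale mult
  for scale :: "'f::field \<Rightarrow> 'a::ab_group_add \<Rightarrow> 'a"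
    and mult :: "'a \<Rightarrow> 'a \<Rightarrow> 'a" +
  fixes \<alpha> :: "'a \<Rightarrow> 'a"
  assumes linear_twist: "Vector_Spaces.linear scale scale \<alpha>"
    and hom_assoc: "mult (\<alpha> x) (mult y z) = mult (mult x y) (\<alpha> z)"

definition trivial_twist :: "('f \<Rightarrow> 'a \<Rightarrow> 'a) \<Rightarrow> ('a \<Rightarrow> 'a) \<Rightarrow> bool" where
  "trivial_twist scale \<alpha> \<longleftrightarrow> (\<exists>c. \<forall>x. \<alpha> x = scale c x)"

definition associative :: "('a \<Rightarrow> 'a \<Rightarrow> 'a) \<Rightarrow> bool" where
  "associative mult \<longleftrightarrow> (\<forall>x y z. mult (mult x y) z = mult x (mult y z))"

definition left_unit :: "('a \<Rightarrow> 'a \<Rightarrow> 'a) \<Rightarrow> 'a \<Rightarrow> bool" where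
  "left_unit mult e \<longleftrightarrow> (\<forall>x. mult e x = x)"

definition two_sided_unit :: "('a \<Rightarrow> 'a \<Rightarrow> 'a) \<Rightarrow> 'a \<Rightarrow> bool" where
  "two_sided_unit mult e \<longleftrightarrow> (\<forall>x. mult e x = x \<and> mult x e = x)"

text \<open>The zero algebra counts as a domain and as a division algebra.\<close>

definition alg_domain :: "('a::zero \<Rightarrow> 'a \<Rightarrow> 'a) \<Rightarrow> bool" where
  "alg_domain mult \<longleftrightarrow>
     (\<forall>a. a \<noteq> 0 \<longrightarrow> inj (\<lambda>x. mult a x) \<and> inj (\<lambda>x. mult x a))"

text \<open>
  In the associative case, invertibility refers to a two-sided unit, whose existence is
  part of being a division algebra; such a unit is unique.
\<close>

definition division_alg :: "('a::zero \<Rightarrow> 'a \<Rightarrow> 'a) \<Rightarrow> bool" where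
  "division_alg mult \<longleftrightarrow>
     (if associative mult
      then \<exists>e. two_sided_unit mult e \<and>
             (\<forall>a. a \<noteq> 0 \<longrightarrow> (\<exists>b. mult a b = e \<and> mult b a = e))
      else \<forall>a. a \<noteq> 0 \<longrightarrow> bij (\<lambda>x. mult a x) \<and> bij (\<lambda>x. mult x a))"

text \<open>Only commutation is required, not association with all pairs of elements.\<close>

definition alg_center :: "('a \<Rightarrow> 'a \<Rightarrow> 'a) \<Rightarrow> 'a set" where
  "alg_center mult = {a. \<forall>x. mult a x = mult x a}"

definition AC_l :: "('a \<Rightarrow> 'a \<Rightarrow> 'a) \<Rightarrow> 'a set" where
  "AC_l mult =
     {a. \<forall>x y z. mult a (mult x z) = mult x (mult a z) \<and>
                 mult (mult a x) (mult y z) = mult a (mult (mult x y) z)}"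

end

theory Submission
  imports Defs
begin

text \<open>
  A twisting map over a left unit \<open>e\<close> is left multiplication by \<open>\<alpha> e\<close>, and
  hom-associativity then puts \<open>\<alpha> e\<close> into \<open>AC_l\<close>. So all but the associative case,
  where \<open>e\<close> turns out to be a right unit as well, follows from one fact: in a left-unital
  domain a nonzero element \<open>a\<close> of \<open>AC_l\<close> forces associativity. Hence in the
  non-associative case \<open>AC_l\<close> is \<open>{0}\<close> and the twisting map is \<open>0\<close>, a trivial one.

  For the key fact, write \<open>R x\<close> for the product of \<open>x\<close> and \<open>e\<close>. Comparing the second
  condition of \<open>AC_l\<close> with its instance at \<open>y = e\<close> and cancelling \<open>a\<close> gives a twisted
  associative law, \<open>(x y) z = R x (y z)\<close>. Thus it suffices that \<open>R\<close> is the identity.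
  The first condition gives \<open>x a = a (R x)\<close>, because \<open>R a = a\<close>. Expanding \<open>(x a) z\<close> through
  this identity, and again by the twisted law and the first condition, gives
  \<open>R (R x) = R x\<close>; and \<open>R\<close> is injective in a domain, being right multiplication by \<open>e\<close>.
\<close>

locale left_unital_domain = nonassoc_algebra scale mult
  for scale :: "'f::field \<Rightarrow> 'a::ab_group_add \<Rightarrow> 'a"
    and mult :: "'a \<Rightarrow> 'a \<Rightarrow> 'a" (infixl "\<star>" 70) +
  fixes e :: 'a
  assumes left_unit: "left_unit mult e"
    and domain: "alg_domain mult"
begin

lemma unit_mult [simp]: "e \<star> x = x"
  using left_unit by (simp add: left_unit_def)

lemma mult_zero_left [simp]: "0 \<star> x = 0"
  using module_hom.zero[OF linear_mult_right[of x, unfolded linear_iff_module_hom]] .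

lemma mult_zero_right [simp]: "x \<star> 0 = 0"
  using module_hom.zero[OF linear_mult_left[of x, unfolded linear_iff_module_hom]] .

lemma left_cancel: "a \<noteq> 0 \<Longrightarrow> a \<star> x = a \<star> y \<longleftrightarrow> x = y"
  using domain unfolding alg_domain_def inj_def by metis

lemma right_cancel: "a \<noteq> 0 \<Longrightarrow> x \<star> a = y \<star> a \<longleftrightarrow> x = y"
  using domain unfolding alg_domain_def inj_def by metis

text \<open>
  For \<open>e = 0\<close> cancellation still holds: then \<open>x\<close>, the product of \<open>e\<close> and \<open>x\<close>, is \<open>0\<close>, so
  the whole algebra is zero.
\<close>

lemma mult_unit_cancel: "x \<star> e = y \<star> e \<longleftrightarrow> x = y"
  by (metis mult_zero_left right_cancel unit_mult)

lemma zero_in_AC_l: "0 \<in> AC_l mult"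
  by (simp add: AC_l_def)

text \<open>
  The existence of one such element \<open>a\<close> suffices because cancelling it turns conditions that
  involve \<open>a\<close> into laws about arbitrary elements.
\<close>

lemma associative_if_nonzero_AC_l:
  assumes a: "a \<in> AC_l mult" and "a \<noteq> 0"
  shows "associative mult"
proof -
  have comm: "a \<star> (x \<star> z) = x \<star> (a \<star> z)"
    and assoc: "(a \<star> x) \<star> (y \<star> z) = a \<star> ((x \<star> y) \<star> z)" for x y z
    using a unfolding AC_l_def by blast+
  have assoc_unit: "(a \<star> x) \<star> z = a \<star> ((x \<star> e) \<star> z)" for x z
    using assoc[of x e z] by simp
  have twisted: "(x \<star> y) \<star> z = (x \<star> e) \<star> (y \<star> z)" for x y z
    using assoc[of x y z] assoc_unit[of x "y \<star> z"] left_cancel[OF \<open>a \<noteq> 0\<close>] by metis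
  have "a \<star> e = a"
    using assoc[of e e e] by (simp add: mult_unit_cancel)
  then have slide: "x \<star> a = a \<star> (x \<star> e)" for x
    using comm[of x e] by simp
  \<comment> \<open>Both ends of the chain are left multiples by \<open>a\<close>; cancelling \<open>a\<close> and then \<open>e\<close> twice
    on the right leaves the claim.\<close>
  have right_unit: "x \<star> e = x" for x
  proof -
    have "a \<star> ((x \<star> e) \<star> e) = (x \<star> e) \<star> (a \<star> e)"
      by (rule comm)
    also have "\<dots> = (x \<star> a) \<star> e"
      by (rule twisted[symmetric])
    also have "\<dots> = a \<star> (((x \<star> e) \<star> e) \<star> e)"
      by (simp add: slide assoc_unit)
    finally show ?thesis
      using \<open>a \<noteq> 0\<close> by (simp add: left_cancel mult_unit_cancel)
  qed
  show ?thesis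
    using twisted by (simp add: associative_def right_unit)
qed

text \<open>
  In the associative case \<open>e\<close> is also a right unit, so the first condition of \<open>AC_l\<close>
  at \<open>z = e\<close> is commutation with \<open>x\<close>.
\<close>

lemma AC_l_eq_center:
  assumes "associative mult"
  shows "AC_l mult = alg_center mult"
proof -
  have assoc: "(x \<star> y) \<star> z = x \<star> (y \<star> z)" for x y z
    using assms by (simp add: associative_def)
  have right_unit: "x \<star> e = x" for x
    using assoc[of x e e] by (simp add: mult_unit_cancel)
  show ?thesis
  proof (intro set_eqI iffI)
    fix a assume "a \<in> AC_l mult"
    then have "a \<star> (x \<star> e) = x \<star> (a \<star> e)" for x
      unfolding AC_l_def by blast
    then have "a \<star> x = x \<star> a" for x
      by (simp only: right_unit)
    then show "a \<in> alg_center mult"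
      unfolding alg_center_def by blast
  next
    fix a assume "a \<in> alg_center mult"
    then have center: "a \<star> x = x \<star> a" for x
      unfolding alg_center_def by blast
    have "a \<star> (x \<star> z) = x \<star> (a \<star> z)" for x z
      using assoc[of a x z] assoc[of x a z] center[of x] by simp
    moreover have "(a \<star> x) \<star> (y \<star> z) = a \<star> ((x \<star> y) \<star> z)" for x y z
      by (simp only: assoc)
    ultimately show "a \<in> AC_l mult"
      unfolding AC_l_def by blast
  qed
qed

lemma AC_l_mult_unit:
  assumes "\<not> associative mult"
  shows "{a \<star> e | a. a \<in> AC_l mult} = {0}"
proof -
  have "AC_l mult = {0}"
    using assms associative_if_nonzero_AC_l zero_in_AC_l by blast
  then show ?thesis
    by simp
qed

end

context hom_associative_algebra
begin

text \<open>This is the hom-associative law at \<open>x = y = e\<close>.\<close>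

lemma twist_eq_mult_left:
  assumes "left_unit mult e"
  shows "\<alpha> z = mult (\<alpha> e) z"
  using hom_assoc[of e e z] assms by (simp add: left_unit_def)

text \<open>
  The hom-associative law at \<open>x = e\<close> moves \<open>\<alpha> e\<close> past the left factor of a product, which is
  the first condition of \<open>AC_l\<close>. The second is the law itself with \<open>\<alpha>\<close> written as left
  multiplication by \<open>\<alpha> e\<close>.
\<close>

lemma twist_unit_in_AC_l:
  assumes "left_unit mult e"
  shows "\<alpha> e \<in> AC_l mult"
proof -
  have comm: "mult (\<alpha> e) (mult y z) = mult y (mult (\<alpha> e) z)" for y z
    using hom_assoc[of e y z] assms twist_eq_mult_left[OF assms, of z]
    by (simp add: left_unit_def)
  have "mult (mult (\<alpha> e) x) (mult y z) = mult (\<alpha> e) (mult (mult x y) z)" for x y z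
    using hom_assoc[of x y z] comm[of "mult x y" z]
      twist_eq_mult_left[OF assms, of x] twist_eq_mult_left[OF assms, of z]
    by simp
  with comm show ?thesis
    unfolding AC_l_def by blast
qed

lemma trivial_or_associative:
  assumes unit: "left_unit mult e" and dom: "alg_domain mult"
  shows "trivial_twist scale \<alpha> \<or> associative mult"
proof -
  interpret left_unital_domain scale mult e
    by unfold_locales (fact unit dom)+
  show ?thesis
  proof (cases "\<alpha> e = 0")
    case True
    then have "\<alpha> z = scale 0 z" for z
      using twist_eq_mult_left[OF unit, of z] by simp
    then show ?thesis
      by (auto simp: trivial_twist_def)
  next
    case False
    then show ?thesis
      using associative_if_nonzero_AC_l twist_unit_in_AC_l[OF unit] by blast
  qed
qed

end

lemma left_unit_if_two_sided: "two_sided_unit mult e \<Longrightarrow> left_unit mult e"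
  by (simp add: two_sided_unit_def left_unit_def)

lemma alg_domain_if_division_alg:
  "division_alg mult \<Longrightarrow> \<not> associative mult \<Longrightarrow> alg_domain mult"
  by (simp add: division_alg_def alg_domain_def bij_is_inj)

theorem theorem46:
  shows
    "(\<forall>(scale :: 'f::field \<Rightarrow> 'a::ab_group_add \<Rightarrow> 'a) mult e.
        nonassoc_algebra scale mult \<and> left_unit mult e \<and> alg_domain mult \<longrightarrow>
          (associative mult \<longrightarrow> AC_l mult = alg_center mult) \<and>
          (\<not> associative mult \<longrightarrow> {mult a e | a. a \<in> AC_l mult} = {0}))
   \<and> (\<forall>(scale :: 'f \<Rightarrow> 'a \<Rightarrow> 'a) mult \<alpha> e.
        hom_associative_algebra scale mult \<alpha> \<and> left_unit mult e \<and> alg_domain mult \<longrightarrow>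
          trivial_twist scale \<alpha> \<or> associative mult)
   \<and> (\<forall>(scale :: 'f \<Rightarrow> 'a \<Rightarrow> 'a) mult \<alpha> e.
        hom_associative_algebra scale mult \<alpha> \<and> two_sided_unit mult e \<and> alg_domain mult \<longrightarrow>
          trivial_twist scale \<alpha> \<or> associative mult)
   \<and> (\<forall>(scale :: 'f \<Rightarrow> 'a \<Rightarrow> 'a) mult \<alpha> e.
        hom_associative_algebra scale mult \<alpha> \<and> two_sided_unit mult e \<and> division_alg mult \<longrightarrow>
          trivial_twist scale \<alpha> \<or> associative mult)"
proof (intro conjI allI impI; elim conjE)
  fix scale :: "'f \<Rightarrow> 'a \<Rightarrow> 'a" and mult e
  assume "nonassoc_algebra scale mult" "left_unit mult e" "alg_domain mult"
  then interpret left_unital_domain scale mult e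
    by (simp add: left_unital_domain_def left_unital_domain_axioms_def)
  show "associative mult \<Longrightarrow> AC_l mult = alg_center mult"
    by (rule AC_l_eq_center)
  show "\<not> associative mult \<Longrightarrow> {mult a e | a. a \<in> AC_l mult} = {0}"
    by (rule AC_l_mult_unit)
next
  fix scale :: "'f \<Rightarrow> 'a \<Rightarrow> 'a" and mult \<alpha> e
  assume "hom_associative_algebra scale mult \<alpha>" "left_unit mult e" "alg_domain mult"
  then show "trivial_twist scale \<alpha> \<or> associative mult"
    by (rule hom_associative_algebra.trivial_or_associative)
next
  fix scale :: "'f \<Rightarrow> 'a \<Rightarrow> 'a" and mult \<alpha> e
  assume "hom_associative_algebra scale mult \<alpha>" "two_sided_unit mult e" "alg_domain mult"
  then show "trivial_twist scale \<alpha> \<or> associative mult"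
    by (metis hom_associative_algebra.trivial_or_associative left_unit_if_two_sided)
next
  fix scale :: "'f \<Rightarrow> 'a \<Rightarrow> 'a" and mult \<alpha> e
  assume "hom_associative_algebra scale mult \<alpha>" "two_sided_unit mult e" "division_alg mult"
  then show "trivial_twist scale \<alpha> \<or> associative mult"
    by (metis hom_associative_algebra.trivial_or_associative left_unit_if_two_sided
        alg_domain_if_division_alg)
qed

end
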